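(* For all integers $m\geq 1$ and $n\geq 1$, and every subset $S\subseteq [m]=\{1,2,\dots,m\}$ with $s=|S|$, the following identity of polynomials in the indeterminate $x$ holds: $$\sum_{T\in \mathcal{T}_{n,m+1}}\ \prod_{v\in \mathcal{I}(T)}\Big(x+\frac{1}{\mathbb{H}_v^S}\Big)=\frac{x+1}{n!}\prod_{i=1}^{n-1}\Big((mn+i+1)(x+1)-(m-s+1)i\Big),$$ or equivalently, $$\sum_{T\in \mathcal{T}_{n,m+1}}\ \prod_{v\in \mathcal{I}(T)}\frac{\big((m-s)\mathbb{H}_v^S+1\big)x-\mathbb{H}_v^S+1}{(m-s+1)\mathbb{H}_v^S}=\frac{1}{mn+1}\binom{(mn+1)x}{n}.$$ (Both identities are asserted.)
   Context: A complete $k$-ary tree is an unlabeled rooted plane tree in which every internal (non-leaf) vertex has exactly $k$ children, linearly ordered from left to right; the tree consisting of a single leaf is the unique one with no internal vertices. $\mathcal{T}_{n,k}$ denotes the (finite) set of complete $k$-ary trees with exactly $n$ internal vertices, and $\mathcal{I}(T)$ denotes the set of internal vertices of $T$. The subset $S\subseteq[m]$ may be empty or all of $[m]$. Second kind of hook length: let $v$ be an internal vertex of a complete $(m+1)$-ary tree $T$ and let $T_v$ be the subtree of $T$ rooted at $v$ (consisting of $v$ and all its descendants). Delete the $r$-th subtree of $v$ for every $r\in S$; then, for each remaining child of $v$ (the $j$-th child with $j\in[m+1]\setminus S$) that is an internal vertex, delete its $r$-th subtree for every $r\in S$; and continue this process down the tree. The result is a complete $(m+1-|S|)$-ary tree $T_v^S$,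 and $\mathbb{H}_v^S$ is the number of internal vertices of $T_v^S$ (counting $v$). Equivalently, $\mathbb{H}_v^S$ is defined recursively by $\mathbb{H}_v^S=1+\sum_{j\in[m+1]\setminus S}\mathbb{H}_{v_j}^S$, where $v_1,\dots,v_{m+1}$ are the children of $v$ from left to right and $\mathbb{H}_w^S=0$ if $w$ is a leaf. The binomial coefficient is the polynomial $\binom{y}{n}=\frac{y(y-1)\cdots(y-n+1)}{n!}$, and empty products equal $1$. *)

theory Defs
  imports "HOL-Computational_Algebra.Polynomial"
begin

datatype tree = Leaf | Node "tree list"

fun complete_kary :: "nat \<Rightarrow> tree \<Rightarrow> bool" where
  "complete_kary k Leaf \<longleftrightarrow> True"
| "complete_kary k (Node ts) \<longleftrightarrow> length ts = k \<and> (\<forall>t\<in>set ts. complete_kary k t)"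

text \<open>A vertex is addressed by the path leading to it from the root: the list of the positions,
  counted from 1 and from left to right, of the children chosen on the way.\<close>

fun subtree_at :: "tree \<Rightarrow> nat list \<Rightarrow> tree option" where
  "subtree_at T [] = Some T"
| "subtree_at Leaf (j # p) = None"
| "subtree_at (Node ts) (j # p) =
     (if 1 \<le> j \<and> j \<le> length ts then subtree_at (ts ! (j - 1)) p else None)"

definition internal_vertices :: "tree \<Rightarrow> nat list set" where
  "internal_vertices T = {v. \<exists>ts. subtree_at T v = Some (Node ts)}"

definition trees :: "nat \<Rightarrow> nat \<Rightarrow> tree set" where
  "trees n k = {T. complete_kary k T \<and> card (internal_vertices T) = n}"

text \<open>Delete the \<open>r\<close>-th subtree, for every \<open>r \<in> S\<close>, at the root and then at all remaining
  internal vertices. The elements of \<open>S\<close> count from 1, list positions from 0.\<close>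

primrec prune :: "nat set \<Rightarrow> tree \<Rightarrow> tree" where
  "prune S Leaf = Leaf"
| "prune S (Node ts) = Node (nths (map (prune S) ts) {i. Suc i \<notin> S})"

definition hook :: "nat set \<Rightarrow> tree \<Rightarrow> nat list \<Rightarrow> nat" where
  "hook S T v = card (internal_vertices (prune S (the (subtree_at T v))))"

abbreviation X :: "rat poly" where
  "X \<equiv> [:0, 1:]"

text \<open>The notation \<open>gchoose\<close> is restricted to fields and thus not available for polynomials.\<close>

definition binomial_poly :: "rat poly \<Rightarrow> nat \<Rightarrow> rat poly" where
  "binomial_poly p n = smult (1 / fact n) (\<Prod>i<n. p - of_nat i)"

lemma poly_binomial_poly: "poly (binomial_poly p n) a = poly p a gchoose n"
  by (simp add: binomial_poly_def gbinomial_prod_rev poly_prod atLeast0LessThan)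

lemma internal_vertices_Leaf [simp]: "internal_vertices Leaf = {}"
proof -
  have "subtree_at Leaf v \<noteq> Some (Node ts)" for v ts by (cases v) auto
  then show ?thesis by (auto simp: internal_vertices_def)
qed

lemma internal_vertices_Node:
  "internal_vertices (Node ts) =
     insert [] (\<Union>i<length ts. (#) (Suc i) ` internal_vertices (ts ! i))"
proof (rule set_eqI)
  fix v
  show "v \<in> internal_vertices (Node ts) \<longleftrightarrow>
    v \<in> insert [] (\<Union>i<length ts. (#) (Suc i) ` internal_vertices (ts ! i))"
  proof (cases v)
    case Nil
    then show ?thesis by (auto simp: internal_vertices_def)
  next
    case (Cons j p)
    then show ?thesis by (cases j) (auto simp: internal_vertices_def image_iff Suc_le_eq Bex_def)
  qed
qed

lemma finite_internal_vertices [simp]: "finite (internal_vertices T)"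
  by (induction T) (auto simp: internal_vertices_Node)

lemma card_internal_vertices_Node:
  "card (internal_vertices (Node ts)) = 1 + (\<Sum>t\<leftarrow>ts. card (internal_vertices t))"
proof -
  have "card (\<Union>i<length ts. (#) (Suc i) ` internal_vertices (ts ! i)) =
      (\<Sum>i<length ts. card ((#) (Suc i) ` internal_vertices (ts ! i)))"
    by (rule card_UN_disjoint) auto
  also have "\<dots> = (\<Sum>i<length ts. card (internal_vertices (ts ! i)))"
    by (intro sum.cong refl card_image) (auto simp: inj_on_def)
  also have "\<dots> = (\<Sum>t\<leftarrow>ts. card (internal_vertices t))"
    by (simp add: sum_list_sum_nth atLeast0LessThan)
  finally show ?thesis
    unfolding internal_vertices_Node by (subst card_insert_disjoint) auto
qed

lemma finite_complete_kary_le: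
  "finite {T. complete_kary k T \<and> card (internal_vertices T) \<le> n}" (is "finite (?A n)")
proof (induction n)
  case 0
  have "?A 0 \<subseteq> {Leaf}"
  proof
    fix T assume "T \<in> ?A 0"
    then show "T \<in> {Leaf}" by (cases T) (auto simp: internal_vertices_Node)
  qed
  then show ?case by (rule finite_subset) simp
next
  case (Suc n)
  have "?A (Suc n) \<subseteq> insert Leaf (Node ` {ts. set ts \<subseteq> ?A n \<and> length ts = k})"
  proof
    fix T assume T: "T \<in> ?A (Suc n)"
    show "T \<in> insert Leaf (Node ` {ts. set ts \<subseteq> ?A n \<and> length ts = k})"
    proof (cases T)
      case (Node ts)
      have "card (internal_vertices t) \<le> n" if "t \<in> set ts" for t
      proof -
        have "card (internal_vertices t) \<le> (\<Sum>t\<leftarrow>ts. card (internal_vertices t))"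
          using that by (intro member_le_sum_list) auto
        also have "\<dots> \<le> n"
          using T by (simp add: Node card_internal_vertices_Node)
        finally show ?thesis .
      qed
      then show ?thesis using T by (auto simp: Node)
    qed simp
  qed
  then show ?case
    by (rule finite_subset) (simp add: finite_lists_length_eq Suc.IH)
qed

lemma finite_trees: "finite (trees n k)"
  by (rule finite_subset [OF _ finite_complete_kary_le [of k n]]) (auto simp: trees_def)

lemma complete_kary_prune:
  assumes "complete_kary (m + 1) T" "S \<subseteq> {1..m}"
  shows "complete_kary (m + 1 - card S) (prune S T)"
  using assms(1)
proof (induction T)
  case (Node ts)
  have "finite S" using assms(2) finite_subset by blast
  have "{i. i < m + 1 \<and> Suc i \<notin> S} = {..<m + 1} - (\<lambda>j. j - 1) ` S"
    using assms(2) by (force simp: image_iff)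
  moreover have "card ({..<m + 1} - (\<lambda>j. j - 1) ` S) = m + 1 - card ((\<lambda>j. j - 1) ` S)"
    using assms(2) \<open>finite S\<close> by (subst card_Diff_subset) fastforce+
  moreover have "card ((\<lambda>j. j - 1) ` S) = card S"
    using assms(2) by (intro card_image inj_on_diff_nat) auto
  ultimately have "card {i. i < m + 1 \<and> Suc i \<notin> S} = m + 1 - card S" by simp
  then show ?case
    using Node by (auto simp: length_nths dest!: in_set_nthsD)
qed simp

lemma hook_Leaf: "subtree_at T v = Some Leaf \<Longrightarrow> hook S T v = 0"
  by (simp add: hook_def)

lemma subtree_at_append:
  "subtree_at T v = Some U \<Longrightarrow> subtree_at T (v @ p) = subtree_at U p"
  by (induction T v rule: subtree_at.induct) (auto split: if_splits)

lemma hook_Node: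
  assumes "subtree_at T v = Some (Node ts)"
  shows "hook S T v = 1 + (\<Sum>j\<in>{1..length ts} - S. hook S T (v @ [j]))"
proof -
  have nths_sum: "(\<Sum>x\<leftarrow>nths xs A. f x) = (\<Sum>i | i < length xs \<and> i \<in> A. f (xs ! i))"
    for xs :: "tree list" and A and f :: "tree \<Rightarrow> nat"
  proof (induction xs arbitrary: A)
    case (Cons x xs)
    have "{i. i < length (x # xs) \<and> i \<in> A} =
        (if 0 \<in> A then {0} else {}) \<union> Suc ` {i. i < length xs \<and> Suc i \<in> A}"
      by (auto simp: image_iff less_Suc_eq_0_disj)
    then show ?case
      by (simp add: nths_Cons Cons.IH sum.reindex)
  qed simp
  have "{1..length ts} - S = Suc ` {i. i < length ts \<and> Suc i \<notin> S}"
  proof (rule set_eqI)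
    fix j show "j \<in> {1..length ts} - S \<longleftrightarrow> j \<in> Suc ` {i. i < length ts \<and> Suc i \<notin> S}"
      by (cases j) auto
  qed
  then have "(\<Sum>j\<in>{1..length ts} - S. hook S T (v @ [j])) =
      (\<Sum>i | i < length ts \<and> Suc i \<notin> S. hook S T (v @ [Suc i]))"
    by (simp add: sum.reindex)
  also have "\<dots> = (\<Sum>i | i < length ts \<and> Suc i \<notin> S. card (internal_vertices (prune S (ts ! i))))"
    by (intro sum.cong refl) (simp add: hook_def subtree_at_append [OF assms])
  finally show ?thesis
    using assms by (simp add: hook_def card_internal_vertices_Node nths_sum)
qed

end

theory Submission
  imports Defs "HOL-Computational_Algebra.Formal_Power_Series"
begin

text \<open>
  Both identities hold because the weighted trees are counted by an algebraic power series whose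
  coefficients are known.  Put \<open>e = m - s\<close>, so that pruning keeps \<open>e + 1\<close> children, and let
  \<open>\<rho> h\<close> be the factor that a vertex of hook length \<open>h\<close> contributes to the second identity at
  \<open>X = x\<close>.  Let \<open>A\<close> be the series in \<open>z\<close> whose \<open>n\<close>-th coefficient is the weighted sum over
  the trees with \<open>n\<close> internal vertices.

  A tree is obtained from its pruned tree \<open>P\<close> by hanging \<open>s\<close> arbitrary trees on every internal
  vertex of \<open>P\<close>, and the weights of the vertices of \<open>P\<close> depend on \<open>P\<close> alone.  Hence
  \<open>A = \<phi>(z A\<^sup>s)\<close>, where \<open>\<phi>\<close> counts weighted complete \<open>(e+1)\<close>-ary trees, without any
  deletion.  The root of such a tree with \<open>h\<close> internal vertices has hook length \<open>h\<close>, so \<open>\<phi>\<close> is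
  determined by the recursion that \<open>\<phi>\<^sub>h\<close> is \<open>\<rho> h\<close> times the coefficient of index \<open>h - 1\<close> of
  \<open>\<phi>\<^bsup>e+1\<^esup>\<close> (\<open>weight_series_eq_compose\<close>).

  If \<open>x\<close> is a positive integer, the recursion is solved by \<open>\<phi> = C\<^sup>x\<close>, where \<open>C = 1 + z C\<^bsup>ex\<^esup>\<close>.
  Indeed, the coefficients of the powers of such a series are the Rothe-Hagen numbers
  (\<open>coeff_power_of_tree_series\<close>), and \<open>\<rho> h\<close> is the quotient of the two that are involved.  With
  \<open>E = C(z A\<^sup>s)\<close> it follows that \<open>A = E\<^sup>x\<close> and
  \<open>E = 1 + z A\<^sup>s E\<^bsup>ex\<^esup> = 1 + z E\<^bsup>mx\<^esup>\<close>, an equation of the same kind as that for \<open>C\<close>.  The coefficients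
  of \<open>A\<close> are therefore Rothe-Hagen numbers as well (\<open>sum_hook_weight_at_nat\<close>).

  This proves the second identity at all positive integers \<open>x\<close>, and thus as an identity of
  polynomials.  The substitution \<open>y + 1 = (e + 1) x / (x + 1)\<close> turns \<open>y + 1 / h\<close> into a constant
  multiple of \<open>\<rho> h\<close>, which gives the first identity at infinitely many points \<open>y\<close>.
\<close>

unbundle fps_syntax

section \<open>Powers of the series \<open>E = 1 + z E\<^sup>t\<close>\<close>

lemma of_nat_choose_Suc:
  "of_nat (Suc n) * of_nat (N choose Suc n) = (of_nat N - of_nat n) * (of_nat (N choose n) :: rat)"
proof -
  have "of_nat (Suc n) * of_nat (N choose Suc n) = (of_nat ((N - n) * (N choose n)) :: rat)"
    unfolding of_nat_mult[symmetric] binomial_absorption binomial_absorb_comp ..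
  also have "\<dots> = (of_nat N - of_nat n) * of_nat (N choose n)"
    by (cases "n \<le> N") (simp_all add: of_nat_diff binomial_eq_0)
  finally show ?thesis .
qed

text \<open>The equation for \<open>E\<close> gives \<open>E\<^bsup>r+1\<^esup> = E\<^sup>r + z E\<^bsup>r+t\<^esup>\<close>.  This is a Pascal-type recursion for
  the coefficients, and the Rothe-Hagen numbers satisfy it too, so that an induction replaces
  Lagrange inversion.\<close>

lemma coeff_power_of_tree_series:
  fixes E :: "rat fps"
  assumes E: "E = 1 + fps_X * E ^ t" and "r > 0"
  shows "(E ^ r) $ n = of_nat r / of_nat (t * n + r) * of_nat (t * n + r choose n)"
proof -
  have E0: "E $ 0 = 1"
    by (subst E) simp
  have rec: "(E ^ Suc r) $ Suc n = (E ^ r) $ Suc n + (E ^ (r + t)) $ n" for r n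
  proof -
    have "E ^ Suc r = E ^ r * (1 + fps_X * E ^ t)"
      using E by (metis power_Suc2)
    also have "\<dots> = E ^ r + fps_X * E ^ (r + t)"
      by (simp add: algebra_simps power_add)
    finally show ?thesis by simp
  qed
  \<comment> \<open>The exponent \<open>r = 0\<close> starts the induction.  There the quotient in the claim can be \<open>0 / 0\<close>,
    hence this form without \<open>t * n + r\<close> in the denominator.\<close>
  have coeff: "of_nat (Suc n) * (E ^ r) $ Suc n = of_nat r * of_nat (t * Suc n + r - 1 choose n)" for r n
  proof (induction n arbitrary: r)
    case 0
    show ?case
    proof (induction r)
      case (Suc r)
      then show ?case unfolding rec by (simp add: E0 fps_nth_power_0)
    qed simp
  next
    case (Suc n)
    note IHn = Suc
    show ?case
    proof (induction r)
      case (Suc r)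
      define M where "M = t * Suc (Suc n) + r"
      show ?case
      proof (cases "M = 0")
        \<comment> \<open>the only case in which the subtraction of \<open>1\<close> in \<open>coeff\<close> is truncated\<close>
        case True
        then have "t = 0" "r = 0" by (auto simp: M_def)
        then show ?thesis using IHn[of 0] unfolding rec by simp
      next
        case False
        then obtain L where L: "M = Suc L" by (cases M) auto
        have M1: "t * Suc (Suc n) + Suc r - 1 = Suc L" "t * Suc (Suc n) + r - 1 = L"
          "t * Suc n + (r + t) - 1 = L"
          using L by (auto simp: M_def)
        have a: "of_nat (Suc (Suc n)) * (E ^ r) $ Suc (Suc n) = of_nat r * (of_nat (L choose Suc n) :: rat)"
          using Suc M1 by simp
        have b: "of_nat (Suc n) * (E ^ (r + t)) $ Suc n = of_nat (r + t) * (of_nat (L choose n) :: rat)"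
          using IHn[of "r + t"] M1 by simp
        have c: "of_nat (Suc n) * of_nat (L choose Suc n) = (of_nat L - of_nat n) * (of_nat (L choose n) :: rat)"
          by (rule of_nat_choose_Suc)
        have "L + 1 = t * (n + 2) + r" using L by (simp add: M_def)
        then have "of_nat (L + 1) = (of_nat (t * (n + 2) + r) :: rat)" by (rule arg_cong)
        then have l: "of_nat L = of_nat t * (of_nat n + 2) + of_nat r - (1 :: rat)"
          by (simp add: algebra_simps)
        have "of_nat (Suc n) * (of_nat (Suc (Suc n)) * (E ^ Suc r) $ Suc (Suc n))
          = of_nat (Suc n) * (of_nat (Suc (Suc n)) * (E ^ r) $ Suc (Suc n)) +
            of_nat (Suc (Suc n)) * (of_nat (Suc n) * (E ^ (r + t)) $ Suc n)"
          unfolding rec by (simp add: algebra_simps)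
        also have "\<dots> = of_nat r * (of_nat (Suc n) * of_nat (L choose Suc n)) +
            of_nat (Suc (Suc n)) * (of_nat (r + t) * of_nat (L choose n))"
          unfolding a b by (simp only: mult.left_commute)
        also have "\<dots> = of_nat (Suc r) * (of_nat (Suc n) * of_nat (L choose Suc n) +
            of_nat (Suc n) * of_nat (L choose n))"
          unfolding c l by (simp add: algebra_simps)
        also have "\<dots> = of_nat (Suc n) * (of_nat (Suc r) * of_nat (Suc L choose Suc n))"
          by (simp add: algebra_simps)
        finally show ?thesis unfolding M1 by (simp only: mult_cancel_left of_nat_eq_0_iff nat.simps simp_thms)
      qed
    qed simp
  qed
  show ?thesis
  proof (cases n)
    case 0
    then show ?thesis using \<open>r > 0\<close> by (simp add: fps_nth_power_0 E0)
  next
    case (Suc k)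
    define M where "M = t * n + r"
    have "M > 0" using \<open>r > 0\<close> by (simp add: M_def)
    then have "n * (M choose n) = M * (M - 1 choose k)"
      unfolding Suc by (metis Suc_diff_1 Suc_times_binomial_eq mult.commute)
    then have absorb: "of_nat n * of_nat (M choose n) = (of_nat M * of_nat (M - 1 choose k) :: rat)"
      by (simp only: of_nat_mult[symmetric])
    have "of_nat n * (of_nat M * (E ^ r) $ n) = of_nat M * (of_nat n * (E ^ r) $ n)"
      by (rule mult.left_commute)
    also have "\<dots> = of_nat M * (of_nat r * of_nat (M - 1 choose k))"
      using coeff[of k r] unfolding M_def Suc by (simp only:)
    also have "\<dots> = of_nat r * (of_nat M * of_nat (M - 1 choose k))"
      by (rule mult.left_commute)
    also have "\<dots> = of_nat n * (of_nat r * of_nat (M choose n))"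
      unfolding absorb[symmetric] by (rule mult.left_commute)
    finally have "of_nat M * (E ^ r) $ n = of_nat r * of_nat (M choose n)"
      using Suc by simp
    then show ?thesis
      using \<open>M > 0\<close> unfolding M_def[symmetric] by (simp add: nonzero_eq_divide_eq mult.commute)
  qed
qed

text \<open>\<open>W = C - 1\<close> has to satisfy \<open>W = z (1 + W)\<^sup>t\<close>, that is, to be the compositional inverse of
  \<open>z / (1 + z)\<^sup>t\<close>.\<close>

lemma tree_series_exists:
  obtains C :: "rat fps" where "C = 1 + fps_X * C ^ t"
proof -
  define V :: "rat fps" where "V = (1 + fps_X) ^ t"
  define a where "a = fps_X * inverse V"
  define W where "W = fps_inv a"
  have V0: "V $ 0 = 1" by (simp add: V_def fps_nth_power_0)
  have a: "a $ 0 = 0" "a $ 1 \<noteq> 0" by (simp_all add: a_def V0)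
  have W0: "W $ 0 = 0" by (simp add: W_def fps_inv_def)
  have "(1 + fps_X) oo W = 1 + W"
    by (simp only: fps_compose_add_distrib fps_compose_1 fps_X_fps_compose_startby0[OF W0])
  then have "V oo W = (1 + W) ^ t"
    unfolding V_def fps_compose_power[OF W0, symmetric] by (rule arg_cong)
  moreover have "a oo W = fps_X" unfolding W_def by (rule fps_inv_right[OF a])
  moreover have "a * V = fps_X"
    unfolding a_def mult.assoc by (subst inverse_mult_eq_1) (simp_all add: V0)
  then have "(a oo W) * (V oo W) = fps_X oo W"
    by (simp only: fps_compose_mult_distrib[OF W0, symmetric])
  then have "(a oo W) * (V oo W) = W"
    by (simp only: fps_X_fps_compose_startby0[OF W0])
  ultimately have "fps_X * (1 + W) ^ t = W" by (simp only:)
  then have "1 + W = 1 + fps_X * (1 + W) ^ t" by (simp only:)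
  then show thesis by (rule that)
qed

section \<open>Hook lengths and weights of trees\<close>

definition pruned_size :: "nat set \<Rightarrow> tree \<Rightarrow> nat" where
  "pruned_size S T = card (internal_vertices (prune S T))"

lemma hook_eq_pruned_size:
  "subtree_at T v = Some U \<Longrightarrow> hook S T v = pruned_size S U"
  by (simp add: hook_def pruned_size_def)

lemma pruned_size_Leaf [simp]: "pruned_size S Leaf = 0"
  by (simp add: pruned_size_def)

lemma pruned_size_Node:
  "pruned_size S (Node ts) =
     Suc (\<Sum>i<length ts. if Suc i \<in> S then 0 else pruned_size S (ts ! i))"
proof -
  have "pruned_size S (Node ts) = hook S (Node ts) []"
    by (simp add: hook_eq_pruned_size)
  also have "\<dots> = 1 + (\<Sum>j\<in>{1..length ts} - S. hook S (Node ts) [j])"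
    by (subst hook_Node) simp_all
  also have "(\<Sum>j\<in>{1..length ts} - S. hook S (Node ts) [j])
    = (\<Sum>j\<in>{1..length ts}. if j \<in> S then 0 else pruned_size S (ts ! (j - 1)))"
    by (rule sum.mono_neutral_cong_left) (auto simp: hook_eq_pruned_size)
  also have "\<dots> = (\<Sum>i<length ts. if Suc i \<in> S then 0 else pruned_size S (ts ! i))"
    by (rule sum.reindex_bij_witness[of _ Suc "\<lambda>j. j - 1"]) auto
  finally show ?thesis by simp
qed

lemma hook_pos: "v \<in> internal_vertices T \<Longrightarrow> hook S T v > 0"
  by (auto simp: internal_vertices_def hook_eq_pruned_size pruned_size_Node)

lemma pruned_size_le: "pruned_size S T \<le> card (internal_vertices T)"
proof (induction T)
  case (Node ts)
  have "pruned_size S (Node ts) \<le> Suc (\<Sum>i<length ts. card (internal_vertices (ts ! i)))"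
    unfolding pruned_size_Node using Node by (auto intro!: sum_mono)
  also have "\<dots> = card (internal_vertices (Node ts))"
    by (simp add: card_internal_vertices_Node sum_list_sum_nth atLeast0LessThan)
  finally show ?case .
qed simp

definition hook_weight :: "nat set \<Rightarrow> (nat \<Rightarrow> 'a::comm_ring_1) \<Rightarrow> tree \<Rightarrow> 'a" where
  "hook_weight S \<rho> T = (\<Prod>v\<in>internal_vertices T. \<rho> (hook S T v))"

lemma hook_weight_Leaf [simp]: "hook_weight S \<rho> Leaf = 1"
  by (simp add: hook_weight_def)

lemma hook_weight_Node:
  "hook_weight S \<rho> (Node ts) = \<rho> (pruned_size S (Node ts)) * (\<Prod>t\<leftarrow>ts. hook_weight S \<rho> t)"
proof -
  have "hook_weight S \<rho> (Node ts) = \<rho> (hook S (Node ts) []) *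
     (\<Prod>v\<in>(\<Union>i<length ts. (#) (Suc i) ` internal_vertices (ts ! i)). \<rho> (hook S (Node ts) v))"
    unfolding hook_weight_def internal_vertices_Node by (subst prod.insert) auto
  also have "(\<Prod>v\<in>(\<Union>i<length ts. (#) (Suc i) ` internal_vertices (ts ! i)). \<rho> (hook S (Node ts) v))
     = (\<Prod>i<length ts. \<Prod>v\<in>(#) (Suc i) ` internal_vertices (ts ! i). \<rho> (hook S (Node ts) v))"
    by (rule prod.UNION_disjoint) auto
  also have "\<dots> = (\<Prod>i<length ts. hook_weight S \<rho> (ts ! i))"
    by (intro prod.cong refl) (simp add: hook_weight_def prod.reindex hook_def)
  also have "\<dots> = (\<Prod>t\<leftarrow>ts. hook_weight S \<rho> t)"
    by (simp add: prod.list_conv_set_nth atLeast0LessThan)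
  finally show ?thesis by (simp add: hook_eq_pruned_size)
qed

section \<open>Generating series of weighted trees\<close>

definition weight_series :: "nat \<Rightarrow> (tree \<Rightarrow> 'a::comm_ring_1) \<Rightarrow> 'a fps" where
  "weight_series k w = Abs_fps (\<lambda>n. \<Sum>T\<in>trees n k. w T)"

text \<open>The outer variable marks the statistic \<open>\<sigma>\<close>, the inner one the number of internal vertices.\<close>

definition refined_series :: "nat \<Rightarrow> (tree \<Rightarrow> 'a::comm_ring_1) \<Rightarrow> (tree \<Rightarrow> nat) \<Rightarrow> 'a fps fps" where
  "refined_series k w \<sigma> = Abs_fps (\<lambda>h. Abs_fps (\<lambda>n. \<Sum>T | T \<in> trees n k \<and> \<sigma> T = h. w T))"

lemma refined_series_const_0: "refined_series k w (\<lambda>_. 0) = fps_const (weight_series k w)"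
  by (auto simp: refined_series_def weight_series_def fps_eq_iff)

definition forests :: "nat \<Rightarrow> nat \<Rightarrow> nat \<Rightarrow> tree list set" where
  "forests k l n = {ts. length ts = l \<and> (\<forall>t\<in>set ts. complete_kary k t) \<and>
     (\<Sum>t\<leftarrow>ts. card (internal_vertices t)) = n}"

lemma finite_forests: "finite (forests k l n)"
proof (rule finite_subset)
  let ?A = "{T. complete_kary k T \<and> card (internal_vertices T) \<le> n}"
  show "forests k l n \<subseteq> {ts. set ts \<subseteq> ?A \<and> length ts = l}"
  proof
    fix ts assume ts: "ts \<in> forests k l n"
    have "card (internal_vertices t) \<le> n" if "t \<in> set ts" for t
    proof -
      have "card (internal_vertices t) \<le> (\<Sum>t\<leftarrow>ts. card (internal_vertices t))"
        using that by (intro member_le_sum_list) auto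
      then show ?thesis using ts by (simp add: forests_def)
    qed
    then show "ts \<in> {ts. set ts \<subseteq> ?A \<and> length ts = l}" using ts by (auto simp: forests_def)
  qed
  show "finite {ts. set ts \<subseteq> ?A \<and> length ts = l}"
    by (intro finite_lists_length_eq finite_complete_kary_le)
qed

text \<open>Each position in a forest has its own statistic, because the root of a tree treats its kept
  and its deleted subtrees differently: the former contribute their pruned size to the hook length,
  the latter nothing.\<close>

lemma prod_list_refined_series:
  "(\<Prod>\<sigma>\<leftarrow>\<sigma>s. refined_series k w \<sigma>) $ h $ n =
     (\<Sum>ts | ts \<in> forests k (length \<sigma>s) n \<and> sum_list (map2 (\<lambda>\<sigma> t. \<sigma> t) \<sigma>s ts) = h. \<Prod>t\<leftarrow>ts. w t)"
proof (induction \<sigma>s arbitrary: h n)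
  case Nil
  have "{ts. ts \<in> forests k 0 n \<and> 0 = h} = (if n = 0 \<and> h = 0 then {[]} else {})"
    by (auto simp: forests_def)
  then show ?case by simp
next
  case (Cons \<sigma> \<sigma>s)
  let ?A = "\<lambda>h n. {T. T \<in> trees n k \<and> \<sigma> T = h}"
  let ?B = "\<lambda>h n. {ts. ts \<in> forests k (length \<sigma>s) n \<and> sum_list (map2 (\<lambda>\<sigma> t. \<sigma> t) \<sigma>s ts) = h}"
  let ?Q = "{ts. ts \<in> forests k (Suc (length \<sigma>s)) n \<and> sum_list (map2 (\<lambda>\<sigma> t. \<sigma> t) (\<sigma> # \<sigma>s) ts) = h}"
  have refined_nth: "refined_series k w \<sigma> $ i $ l = (\<Sum>T\<in>?A i l. w T)" for i l
    by (simp add: refined_series_def)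
  have fin: "finite ?Q" using finite_forests by simp
  have "(\<Prod>\<sigma>\<leftarrow>\<sigma> # \<sigma>s. refined_series k w \<sigma>) $ h $ n =
     (\<Sum>i\<le>h. \<Sum>l\<le>n. (\<Sum>T\<in>?A i l. w T) * (\<Sum>ts\<in>?B (h - i) (n - l). \<Prod>t\<leftarrow>ts. w t))"
    by (simp add: fps_mult_nth fps_sum_nth Cons.IH atLeast0AtMost refined_nth)
  also have "\<dots> = (\<Sum>p\<in>{..h} \<times> {..n}.
      (\<Sum>ts | ts \<in> ?Q \<and> (\<sigma> (hd ts), card (internal_vertices (hd ts))) = p. \<Prod>t\<leftarrow>ts. w t))"
    unfolding sum.cartesian_product
  proof (rule sum.cong[OF refl])
    fix p assume "p \<in> {..h} \<times> {..n}"
    then obtain i l where p: "p = (i, l)" and il: "i \<le> h" "l \<le> n" by auto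
    have "(\<Sum>T\<in>?A i l. w T) * (\<Sum>ts\<in>?B (h - i) (n - l). \<Prod>t\<leftarrow>ts. w t)
      = (\<Sum>(T, ts)\<in>?A i l \<times> ?B (h - i) (n - l). w T * (\<Prod>t\<leftarrow>ts. w t))"
      by (simp add: sum_product sum.cartesian_product)
    also have "\<dots> = (\<Sum>ts | ts \<in> ?Q \<and> (\<sigma> (hd ts), card (internal_vertices (hd ts))) = (i, l). \<Prod>t\<leftarrow>ts. w t)"
      using il
      by (intro sum.reindex_bij_witness[of _ "\<lambda>ts. (hd ts, tl ts)" "\<lambda>(T, ts). T # ts"])
        (auto simp: forests_def trees_def length_Suc_conv)
    finally show "(case p of (i, l) \<Rightarrow> (\<Sum>T\<in>?A i l. w T) * (\<Sum>ts\<in>?B (h - i) (n - l). \<Prod>t\<leftarrow>ts. w t)) =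
      (\<Sum>ts | ts \<in> ?Q \<and> (\<sigma> (hd ts), card (internal_vertices (hd ts))) = p. \<Prod>t\<leftarrow>ts. w t)"
      unfolding p prod.case .
  qed
  also have "\<dots> = (\<Sum>ts\<in>?Q. \<Prod>t\<leftarrow>ts. w t)"
  proof -
    have "(\<lambda>ts. (\<sigma> (hd ts), card (internal_vertices (hd ts)))) ` ?Q \<subseteq> {..h} \<times> {..n}"
      by (auto simp: forests_def length_Suc_conv)
    from sum.group[OF fin _ this] show ?thesis
      by blast
  qed
  finally show ?case by simp
qed

lemma card_shifted:
  assumes "S \<subseteq> {1..k}"
  shows "card {i. i < k \<and> Suc i \<in> S} = card S" "card {i. i < k \<and> Suc i \<notin> S} = k - card S"
proof -
  have "Suc ` {i. i < k \<and> Suc i \<in> S} = S"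
  proof (intro equalityI subsetI)
    fix j assume "j \<in> S"
    then show "j \<in> Suc ` {i. i < k \<and> Suc i \<in> S}" using assms by (cases j) auto
  qed auto
  then show *: "card {i. i < k \<and> Suc i \<in> S} = card S"
    by (metis card_image inj_Suc)
  have "{i. i < k \<and> Suc i \<notin> S} = {..<k} - {i. i < k \<and> Suc i \<in> S}" by auto
  then show "card {i. i < k \<and> Suc i \<notin> S} = k - card S"
    using * by (simp add: card_Diff_subset Collect_conj_eq lessThan_def)
qed

text \<open>The recursion cuts a tree at its root.  The \<open>k - card S\<close> kept subtrees share the remaining
  \<open>h\<close> vertices of the pruned tree; the \<open>card S\<close> deleted ones are arbitrary.\<close>

lemma refined_series_rec:
  fixes \<rho> :: "nat \<Rightarrow> 'a::comm_ring_1"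
  assumes S: "S \<subseteq> {1..k}"
  defines "w \<equiv> hook_weight S \<rho>"
  defines "R \<equiv> refined_series k w (pruned_size S)"
  defines "A \<equiv> weight_series k w"
  shows "R $ 0 = 1"
    and "R $ Suc h = fps_const (\<rho> (Suc h)) * (fps_X * A ^ card S) * (R ^ (k - card S)) $ h"
proof -
  have size0: "pruned_size S T = 0 \<longleftrightarrow> T = Leaf" for T
    by (cases T) (auto simp: pruned_size_Node)
  show "R $ 0 = 1"
  proof (rule fps_ext)
    fix n
    have "{T. T \<in> trees n k \<and> pruned_size S T = 0} = (if n = 0 then {Leaf} else {})"
      unfolding size0 by (auto simp: trees_def)
    then have "R $ 0 $ n = sum w (if n = 0 then {Leaf} else {})"
      by (simp only: R_def refined_series_def fps_nth_Abs_fps)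
    then show "R $ 0 $ n = 1 $ n" by (simp add: w_def)
  qed
  define \<sigma>s where "\<sigma>s = map (\<lambda>i. if Suc i \<in> S then (\<lambda>_. 0) else pruned_size S) [0..<k]"
  have len: "length \<sigma>s = k" by (simp add: \<sigma>s_def)
  have stat: "pruned_size S (Node ts) = Suc (sum_list (map2 (\<lambda>\<sigma> t. \<sigma> t) \<sigma>s ts))"
    if "length ts = k" for ts
    using that by (auto simp: pruned_size_Node sum_list_sum_nth len atLeast0LessThan \<sigma>s_def intro!: sum.cong)
  have P: "(\<Prod>\<sigma>\<leftarrow>\<sigma>s. refined_series k w \<sigma>) = R ^ (k - card S) * fps_const (A ^ card S)"
  proof -
    have "(\<Prod>\<sigma>\<leftarrow>\<sigma>s. refined_series k w \<sigma>) = (\<Prod>i<k. if Suc i \<in> S then fps_const A else R)"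
      by (auto simp: prod.list_conv_set_nth len atLeast0LessThan \<sigma>s_def refined_series_const_0 A_def R_def
          intro!: prod.cong)
    also have "\<dots> = fps_const A ^ card S * R ^ (k - card S)"
    proof -
      have "{..<k} \<inter> {i. Suc i \<in> S} = {i. i < k \<and> Suc i \<in> S}"
        "{..<k} \<inter> - {i. Suc i \<in> S} = {i. i < k \<and> Suc i \<notin> S}" by auto
      then show ?thesis using card_shifted[OF S] by (simp add: prod.If_cases)
    qed
    finally show ?thesis by (simp add: fps_const_power mult.commute)
  qed
  have coeff: "R $ Suc h $ Suc n = \<rho> (Suc h) * (\<Prod>\<sigma>\<leftarrow>\<sigma>s. refined_series k w \<sigma>) $ h $ n" for n
  proof -
    have "R $ Suc h $ Suc n = (\<Sum>T | T \<in> trees (Suc n) k \<and> pruned_size S T = Suc h. w T)"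
      by (simp add: R_def refined_series_def)
    also have "\<dots> = (\<Sum>ts | ts \<in> forests k (length \<sigma>s) n \<and> sum_list (map2 (\<lambda>\<sigma> t. \<sigma> t) \<sigma>s ts) = h.
        w (Node ts))"
      by (rule sum.reindex_bij_witness[of _ Node "\<lambda>T. case T of Node ts \<Rightarrow> ts"])
        (auto simp: trees_def forests_def card_internal_vertices_Node len stat split: tree.splits)
    also have "\<dots> = (\<Sum>ts | ts \<in> forests k (length \<sigma>s) n \<and> sum_list (map2 (\<lambda>\<sigma> t. \<sigma> t) \<sigma>s ts) = h.
        \<rho> (Suc h) * (\<Prod>t\<leftarrow>ts. w t))"
      by (intro sum.cong refl) (auto simp: w_def hook_weight_Node stat forests_def len)
    finally show ?thesis by (simp add: prod_list_refined_series sum_distrib_left)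
  qed
  have coeff0: "R $ Suc h $ 0 = 0"
  proof -
    have "pruned_size S T \<noteq> Suc h" if "T \<in> trees 0 k" for T
      using pruned_size_le[of S T] that by (simp add: trees_def)
    then have "{T. T \<in> trees 0 k \<and> pruned_size S T = Suc h} = {}" by blast
    then show ?thesis
      by (simp only: R_def refined_series_def fps_nth_Abs_fps sum.empty)
  qed
  have "R $ Suc h = fps_X * (fps_const (\<rho> (Suc h)) * ((R ^ (k - card S)) $ h * A ^ card S))"
  proof (rule fps_ext)
    fix n
    show "R $ Suc h $ n = (fps_X * (fps_const (\<rho> (Suc h)) * ((R ^ (k - card S)) $ h * A ^ card S))) $ n"
      by (cases n) (simp_all add: coeff coeff0 P)
  qed
  then show "R $ Suc h = fps_const (\<rho> (Suc h)) * (fps_X * A ^ card S) * (R ^ (k - card S)) $ h"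
    by (simp only: mult_ac)
qed

lemma weight_series_eq_sum_refined:
  "weight_series k w $ n = (\<Sum>h\<le>n. refined_series k w (pruned_size S) $ h $ n)"
proof -
  have "pruned_size S ` trees n k \<subseteq> {..n}"
    using pruned_size_le[of S] by (auto simp: trees_def)
  from sum.group[OF finite_trees _ this, of w] show ?thesis
    by (simp add: weight_series_def refined_series_def)
qed

section \<open>Reduction to trees without deletion\<close>

text \<open>The hypothesis says that \<open>R\<close> agrees with \<open>\<phi>(u Y)\<close> up to order \<open>h\<close> in its outer variable \<open>u\<close>.
  The substitution of \<open>u Y\<close> is multiplicative, so powers agree to the same order.\<close>

lemma power_nth_scaled:
  fixes R :: "'a::comm_ring_1 fps fps"
  assumes "\<And>j. j \<le> h \<Longrightarrow> R $ j = fps_const (\<phi> $ j) * Y ^ j" and "j \<le> h"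
  shows "(R ^ e) $ j = fps_const ((\<phi> ^ e) $ j) * Y ^ j"
  using \<open>j \<le> h\<close>
proof (induction e arbitrary: j)
  case 0
  then show ?case by (cases j) auto
next
  case (Suc e)
  have const_sum: "(\<Sum>i\<in>I. fps_const (f i)) = fps_const (sum f I)" for f :: "nat \<Rightarrow> 'a" and I
    by (induction I rule: infinite_finite_induct) simp_all
  have "(R ^ Suc e) $ j = (\<Sum>i=0..j. (fps_const (\<phi> $ i) * Y ^ i) * (fps_const ((\<phi> ^ e) $ (j - i)) * Y ^ (j - i)))"
    using Suc assms(1) by (simp add: fps_mult_nth)
  also have "\<dots> = (\<Sum>i=0..j. fps_const (\<phi> $ i * (\<phi> ^ e) $ (j - i)) * Y ^ j)"
  proof (intro sum.cong refl)
    fix i assume "i \<in> {0..j}"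
    then have "Y ^ j = Y ^ i * Y ^ (j - i)" by (simp add: power_add[symmetric])
    then show "fps_const (\<phi> $ i) * Y ^ i * (fps_const ((\<phi> ^ e) $ (j - i)) * Y ^ (j - i)) =
      fps_const (\<phi> $ i * (\<phi> ^ e) $ (j - i)) * Y ^ j"
      by (simp add: fps_const_mult[symmetric] mult_ac del: fps_const_mult)
  qed
  also have "\<dots> = fps_const ((\<phi> ^ Suc e) $ j) * Y ^ j"
    by (simp only: power_Suc fps_mult_nth sum_distrib_right[symmetric] const_sum)
  finally show ?case .
qed

text \<open>The recursion for the series refined by pruned size differs from that for \<open>\<phi>\<close> only by one factor
  \<open>z A\<^bsup>card S\<^esup>\<close> per vertex of the pruned tree: this vertex itself and the trees deleted at it.\<close>

lemma weight_series_eq_compose: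
  fixes \<rho> :: "nat \<Rightarrow> 'a::comm_ring_1"
  assumes S: "S \<subseteq> {1..k}"
    and \<phi>0: "\<phi> $ 0 = 1"
    and \<phi>: "\<And>h. \<phi> $ Suc h = \<rho> (Suc h) * (\<phi> ^ (k - card S)) $ h"
  defines "A \<equiv> weight_series k (hook_weight S \<rho>)"
  shows "A = \<phi> oo (fps_X * A ^ card S)"
proof -
  define R where "R = refined_series k (hook_weight S \<rho>) (pruned_size S)"
  define Y where "Y = fps_X * A ^ card S"
  note rec = refined_series_rec[OF S, of \<rho>, folded R_def A_def Y_def]
  have R: "R $ h = fps_const (\<phi> $ h) * Y ^ h" for h
  proof (induction h rule: less_induct)
    case (less h)
    show ?case
    proof (cases h)
      case 0
      then show ?thesis by (simp add: rec \<phi>0)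
    next
      case (Suc h')
      have "(R ^ (k - card S)) $ h' = fps_const ((\<phi> ^ (k - card S)) $ h') * Y ^ h'"
        by (rule power_nth_scaled[where h = h']) (use less Suc in auto)
      then show ?thesis
        by (simp add: Suc rec \<phi> fps_const_mult[symmetric] mult_ac del: fps_const_mult)
    qed
  qed
  show ?thesis
    unfolding Y_def[symmetric]
    by (rule fps_ext) (simp add: A_def weight_series_eq_sum_refined[of _ _ _ S] R_def[symmetric] R
        fps_compose_nth atLeast0AtMost)
qed

section \<open>Evaluation at positive integers\<close>

text \<open>With \<open>N = x (e h + 1)\<close>, the weight \<open>\<rho> h = (N - h + 1) / ((e + 1) h)\<close> is the quotient of
  \<open>x / N * (N choose h)\<close>, the coefficient of index \<open>h\<close> in \<open>C\<^sup>x\<close>, and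
  \<open>(e + 1) x / N * (N choose (h - 1))\<close>, the coefficient of index \<open>h - 1\<close> in \<open>C\<^bsup>(e+1)x\<^esup>\<close>.\<close>

lemma sum_hook_weight_at_nat:
  assumes S: "S \<subseteq> {1..m}" and "x > 0"
  defines "e \<equiv> m - card S"
  defines "\<rho> \<equiv> \<lambda>h. (of_nat (x * (e * h + 1)) + 1 - of_nat h) / (of_nat (Suc e) * of_nat h) :: rat"
  shows "(\<Sum>T\<in>trees n (m + 1). hook_weight S \<rho> T) =
    of_nat ((m * n + 1) * x choose n) / of_nat (m * n + 1)"
proof -
  have "card S \<le> m" using S card_mono[of "{1..m}" S] by simp
  then have k: "m + 1 - card S = Suc e" and m: "m = card S + e" by (simp_all add: e_def)
  have S': "S \<subseteq> {1..m + 1}" using S by auto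
  obtain C :: "rat fps" where C: "C = 1 + fps_X * C ^ (e * x)"
    by (rule tree_series_exists)
  have C0: "C $ 0 = 1" by (subst C) simp
  define \<phi> where "\<phi> = C ^ x"
  have \<phi>: "\<phi> $ Suc h = \<rho> (Suc h) * (\<phi> ^ (m + 1 - card S)) $ h" for h
  proof -
    define N where "N = x * (e * Suc h + 1)"
    have N: "e * x * Suc h + x = N" "e * x * h + Suc e * x = N"
      by (simp_all add: N_def algebra_simps)
    have "N > 0" using \<open>x > 0\<close> by (simp add: N_def)
    define D H :: rat where "D = of_nat (Suc e)" and "H = of_nat (Suc h)"
    have "D \<noteq> 0" "H \<noteq> 0" by (simp_all only: D_def H_def of_nat_neq_0 not_False_eq_True)
    have "\<rho> (Suc h) = (of_nat N - of_nat h) / (D * H)"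
      unfolding \<rho>_def N_def[symmetric] by (simp add: D_def H_def)
    moreover have "(\<phi> ^ (m + 1 - card S)) $ h = D * of_nat x / of_nat N * of_nat (N choose h)"
      unfolding \<phi>_def k power_mult[symmetric] mult.commute[of x] D_def
      using coeff_power_of_tree_series[OF C, of "Suc e * x" h] \<open>x > 0\<close> unfolding N of_nat_mult by simp
    ultimately have "\<rho> (Suc h) * (\<phi> ^ (m + 1 - card S)) $ h =
        of_nat x / of_nat N * ((of_nat N - of_nat h) * of_nat (N choose h)) / H"
      using \<open>D \<noteq> 0\<close> by (simp add: ac_simps)
    also have "(of_nat N - of_nat h) * of_nat (N choose h) = H * of_nat (N choose Suc h)"
      unfolding H_def by (rule of_nat_choose_Suc[symmetric])
    also have "of_nat x / of_nat N * (H * of_nat (N choose Suc h)) / H = \<phi> $ Suc h"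
      unfolding \<phi>_def coeff_power_of_tree_series[OF C \<open>x > 0\<close>] N using \<open>H \<noteq> 0\<close> by simp
    finally show ?thesis ..
  qed
  define A where "A = weight_series (m + 1) (hook_weight S \<rho>)"
  define Y where "Y = fps_X * A ^ card S"
  \<comment> \<open>\<open>E\<close> satisfies an equation of the same kind as \<open>C\<close>, with exponent \<open>m * x\<close> instead of \<open>e * x\<close>.\<close>
  define E where "E = C oo Y"
  have Y0: "Y $ 0 = 0" by (simp add: Y_def)
  have "A = \<phi> oo Y"
    unfolding A_def Y_def by (rule weight_series_eq_compose[OF S' _ \<phi>]) (simp add: \<phi>_def C0 fps_nth_power_0)
  then have A: "A = E ^ x"
    by (simp add: \<phi>_def E_def fps_compose_power[OF Y0])
  have "E = (1 + fps_X * C ^ (e * x)) oo Y"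
    unfolding E_def by (rule arg_cong[OF C])
  also have "\<dots> = 1 + Y * E ^ (e * x)"
    by (simp add: E_def fps_compose_add_distrib fps_compose_mult_distrib[OF Y0]
        fps_compose_power[OF Y0] Y0)
  also have "\<dots> = 1 + fps_X * E ^ (m * x)"
    by (simp add: Y_def A m power_add[symmetric] power_mult[symmetric] algebra_simps)
  finally have E: "E = 1 + fps_X * E ^ (m * x)" .
  have "(\<Sum>T\<in>trees n (m + 1). hook_weight S \<rho> T) = A $ n"
    by (simp add: A_def weight_series_def)
  also have "\<dots> = of_nat x / of_nat (m * x * n + x) * of_nat (m * x * n + x choose n)"
    unfolding A by (rule coeff_power_of_tree_series[OF E \<open>x > 0\<close>])
  also have "m * x * n + x = (m * n + 1) * x" by (simp add: algebra_simps)
  finally show ?thesis using \<open>x > 0\<close> by (simp only: of_nat_mult) simp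
qed

section \<open>The polynomial identities\<close>

lemma poly_eqI_infinite:
  fixes p q :: "'a::idom poly"
  assumes "infinite (range f)" and "\<And>x. poly p (f x) = poly q (f x)"
  shows "p = q"
proof (rule ccontr)
  assume "p \<noteq> q"
  then have "finite {a. poly (p - q) a = 0}" by (intro poly_roots_finite) simp
  moreover have "range f \<subseteq> {a. poly (p - q) a = 0}" using assms(2) by auto
  ultimately show False using assms(1) finite_subset by blast
qed

lemma of_nat_choose_eq_prod:
  assumes "n \<ge> 1"
  shows "(of_nat (N choose n) :: rat) = of_nat N * (\<Prod>i=1..n-1. of_nat N - of_nat i) / fact n"
proof -
  have "{..<n} = insert 0 {1..n-1}" using assms by auto
  then show ?thesis
    by (simp add: binomial_gbinomial gbinomial_prod_rev atLeast0LessThan)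
qed

theorem theorem1p2:
  fixes m n s :: nat and S :: "nat set"
  assumes "m \<ge> 1" and "n \<ge> 1" and "S \<subseteq> {1..m}" and "s = card S"
  shows "(\<Sum>T\<in>trees n (m + 1). \<Prod>v\<in>internal_vertices T. X + [:1 / of_nat (hook S T v):]) =
      smult (1 / fact n) ((X + 1) *
        (\<Prod>i = 1..n - 1. of_nat (m * n + i + 1) * (X + 1) - (of_nat m - of_nat s + 1) * of_nat i))
    \<and> (\<Sum>T\<in>trees n (m + 1). \<Prod>v\<in>internal_vertices T.
        smult (1 / ((of_nat m - of_nat s + 1) * of_nat (hook S T v)))
          (((of_nat m - of_nat s) * of_nat (hook S T v) + 1) * X - of_nat (hook S T v) + 1)) =
      smult (1 / of_nat (m * n + 1)) (binomial_poly (of_nat (m * n + 1) * X) n)"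
    (is "?L1 = ?R1 \<and> ?L2 = ?R2")
proof -
  define e where "e = m - card S"
  have "card S \<le> m" using assms(3) card_mono[of "{1..m}" S] by simp
  then have m: "m = s + e" using assms(4) by (simp add: e_def)
  define \<rho> :: "nat \<Rightarrow> nat \<Rightarrow> rat" where
    "\<rho> x h = (of_nat (x * (e * h + 1)) + 1 - of_nat h) / (of_nat (Suc e) * of_nat h)" for x h
  have sum_\<rho>: "(\<Sum>T\<in>trees n (m + 1). \<Prod>v\<in>internal_vertices T. \<rho> x (hook S T v)) =
      of_nat ((m * n + 1) * x choose n) / of_nat (m * n + 1)" if "x > 0" for x
    using sum_hook_weight_at_nat[OF assms(3) that, of n]
    by (simp add: hook_weight_def \<rho>_def[abs_def] e_def)
  define a :: "nat \<Rightarrow> rat" where "a j = of_nat (Suc j)" for j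
  have "inj a" by (auto simp: inj_def a_def)
  then have inf_a: "infinite (range a)" by (simp add: finite_image_iff)
  have second: "?L2 = ?R2"
  proof (rule poly_eqI_infinite[OF inf_a])
    fix j
    have "poly (smult (1 / ((of_nat m - of_nat s + 1) * of_nat h))
        (((of_nat m - of_nat s) * of_nat h + 1) * X - of_nat h + 1)) (a j) = \<rho> (Suc j) h" for h
    proof -
      have "((of_nat m - of_nat s) * of_nat h + 1) * a j - of_nat h + 1 =
          of_nat (Suc j * (e * h + 1)) + 1 - of_nat h"
        by (simp add: m a_def algebra_simps)
      moreover have "of_nat m - of_nat s + 1 = (of_nat (Suc e) :: rat)"
        by (simp add: m)
      moreover have "poly (smult (1 / ((of_nat m - of_nat s + 1) * of_nat h))
          (((of_nat m - of_nat s) * of_nat h + 1) * X - of_nat h + 1)) (a j) =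
          (((of_nat m - of_nat s) * of_nat h + 1) * a j - of_nat h + 1) / ((of_nat m - of_nat s + 1) * of_nat h)"
        by (simp add: mult.commute)
      ultimately show ?thesis by (simp only: \<rho>_def)
    qed
    then have "poly ?L2 (a j) = (\<Sum>T\<in>trees n (m + 1). \<Prod>v\<in>internal_vertices T. \<rho> (Suc j) (hook S T v))"
      by (simp only: poly_sum poly_prod)
    also have "\<dots> = poly ?R2 (a j)"
    proof -
      have "poly (of_nat (m * n + 1) * X) (a j) = of_nat ((m * n + 1) * Suc j)"
        by (simp add: a_def algebra_simps)
      then show ?thesis
        by (simp only: sum_\<rho>[OF zero_less_Suc] poly_smult poly_binomial_poly binomial_gbinomial
            times_divide_eq_left mult_1)
    qed
    finally show "poly ?L2 (a j) = poly ?R2 (a j)" .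
  qed
  \<comment> \<open>At \<open>X = b j\<close> each factor of the first identity is \<open>c\<close> times the factor of the second
    at \<open>X = a j\<close>, with one constant \<open>c\<close> for all hook lengths.\<close>
  define b :: "nat \<Rightarrow> rat" where "b j = of_nat (Suc e) * a j / (a j + 1) - 1" for j
  have a1: "a j + 1 > 0" for j by (simp add: a_def)
  have "inj b"
  proof (rule injI)
    fix i j assume "b i = b j"
    then have "of_nat (Suc e) * (a i / (a i + 1)) = of_nat (Suc e) * (a j / (a j + 1))"
      by (simp add: b_def)
    then have "a i / (a i + 1) = a j / (a j + 1)"
      by (simp only: mult_cancel_left of_nat_eq_0_iff nat.simps simp_thms)
    then have "a i = a j" using a1[of i] a1[of j] by (simp add: field_simps)
    then show "i = j" using \<open>inj a\<close> by (simp add: inj_def)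
  qed
  then have inf_b: "infinite (range b)" by (simp add: finite_image_iff)
  have first: "?L1 = ?R1"
  proof (rule poly_eqI_infinite[OF inf_b])
    fix j
    define x where "x = a j"
    define c where "c = of_nat (Suc e) / (x + 1)"
    have x: "x = of_nat (Suc j)" "x + 1 > 0" by (simp_all add: x_def a_def)
    have b: "b j + 1 = c * x" by (simp add: b_def c_def x_def)
    have w: "b j + 1 / of_nat h = c * \<rho> (Suc j) h" if "h > 0" for h
    proof -
      have "c * \<rho> (Suc j) h = (of_nat (Suc j * (e * h + 1)) + 1 - of_nat h) / ((x + 1) * of_nat h)"
        by (simp add: c_def \<rho>_def del: of_nat_Suc of_nat_mult of_nat_add)
      also have "of_nat (Suc j * (e * h + 1)) = x * (of_nat e * of_nat h + 1)"
        unfolding of_nat_mult x(1)[symmetric] by simp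
      finally show ?thesis
        using that x(2) by (simp add: b_def x_def[symmetric] field_simps)
    qed
    have "poly ?L1 (b j) = (\<Sum>T\<in>trees n (m + 1). \<Prod>v\<in>internal_vertices T. c * \<rho> (Suc j) (hook S T v))"
      unfolding poly_sum poly_prod
      by (intro sum.cong prod.cong refl) (simp add: w[symmetric] hook_pos)
    also have "\<dots> = c ^ n * (\<Sum>T\<in>trees n (m + 1). \<Prod>v\<in>internal_vertices T. \<rho> (Suc j) (hook S T v))"
      by (simp add: prod.distrib sum_distrib_left trees_def)
    also have "\<dots> = c ^ n * x * (\<Prod>i=1..n-1. of_nat (m * n + 1) * x - of_nat i) / fact n"
      unfolding sum_\<rho>[OF zero_less_Suc] of_nat_choose_eq_prod[OF assms(2)] of_nat_mult x(1)[symmetric]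
      by (simp del: of_nat_add of_nat_Suc)
    also have "\<dots> = c * x * (\<Prod>i=1..n-1. c * (of_nat (m * n + 1) * x - of_nat i)) / fact n"
      using assms(2) by (simp add: prod.distrib power_eq_if)
    also have "(\<Prod>i=1..n-1. c * (of_nat (m * n + 1) * x - of_nat i)) =
        (\<Prod>i=1..n-1. of_nat (m * n + i + 1) * (b j + 1) - of_nat (Suc e) * of_nat i)"
    proof (rule prod.cong[OF refl])
      fix i
      have "of_nat (Suc e) = c * (x + 1)" using x(2) by (simp add: c_def)
      then show "c * (of_nat (m * n + 1) * x - of_nat i) =
          of_nat (m * n + i + 1) * (b j + 1) - of_nat (Suc e) * of_nat i"
        unfolding b by (simp add: algebra_simps)
    qed
    also have "c * x * \<dots> / fact n = poly ?R1 (b j)"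
      unfolding b[symmetric] by (simp add: poly_prod m add.commute)
    finally show "poly ?L1 (b j) = poly ?R1 (b j)" .
  qed
  from first second show ?thesis ..
qed

end
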